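(* Let $x=(x_1,\dots,x_n)\in\mathbb{N}^n$, put $u_i=x_1+\cdots+x_i$ for $1\le i\le n$, and let $\tilde u=(u_n,u_{n-1},\dots,u_1)$, which is a partition. Then the number $N(\Pi_n(x))=\#(\Pi_n(x)\cap\mathbb{Z}^n)$ of integer points in $\Pi_n(x)$ is equal to the number of plane partitions of shape $\tilde u$ and largest part at most $2$.
   Context: $\mathbb N=\{0,1,2,\dots\}$. $\Pi_n(x)=\{y\in\mathbb{R}^n: y_i\ge 0,\ y_1+\cdots+y_i\le x_1+\cdots+x_i \text{ for all } 1\le i\le n\}$. For a partition $\lambda=(\lambda_1\ge\cdots\ge\lambda_\ell\ge 0)$, a plane partition of shape $\lambda$ and largest part at most $m$ is an array $(\pi_{ij})$ of integers with $1\le\pi_{ij}\le m$, defined for $1\le i\le\ell$, $1\le j\le\lambda_i$, which is weakly decreasing along rows and columns. *)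

theory Defs
  imports Complex_Main "HOL-Library.FuncSet"
begin

text \<open>
  A vector \<open>(x\<^sub>1, \<dots>, x\<^sub>n)\<close> is a function on \<^typ>\<open>nat\<close> of which only the values at \<open>{1..n}\<close> matter.
  Wherever vectors or arrays are counted, they are taken from an extensional function
  space \<open>\<rightarrow>\<^sub>E\<close>, so that each of them is represented by exactly one function.
\<close>

definition pitman_stanley :: "nat \<Rightarrow> (nat \<Rightarrow> real) \<Rightarrow> (nat \<Rightarrow> real) set" where
  "pitman_stanley n x =
    {y \<in> {1..n} \<rightarrow>\<^sub>E (UNIV :: real set).
       \<forall>i\<in>{1..n}. 0 \<le> y i \<and> (\<Sum>k=1..i. y k) \<le> (\<Sum>k=1..i. x k)}"

definition num_integer_points :: "nat \<Rightarrow> (nat \<Rightarrow> real) set \<Rightarrow> nat" where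
  "num_integer_points n P = card (P \<inter> ({1..n} \<rightarrow>\<^sub>E \<int>))"

definition is_partition :: "nat \<Rightarrow> (nat \<Rightarrow> nat) \<Rightarrow> bool" where
  "is_partition l lam \<longleftrightarrow> (\<forall>i j. 1 \<le> i \<and> i \<le> j \<and> j \<le> l \<longrightarrow> lam j \<le> lam i)"

definition young_diagram :: "nat \<Rightarrow> (nat \<Rightarrow> nat) \<Rightarrow> (nat \<times> nat) set" where
  "young_diagram l lam = (SIGMA i:{1..l}. {1..lam i})"

text \<open>Plane partitions of shape \<open>lam\<close> (with \<open>l\<close> rows) and largest part at most \<open>m\<close>.\<close>

definition plane_partitions :: "nat \<Rightarrow> (nat \<Rightarrow> nat) \<Rightarrow> int \<Rightarrow> (nat \<times> nat \<Rightarrow> int) set" where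
  "plane_partitions l lam m =
    {p \<in> young_diagram l lam \<rightarrow>\<^sub>E {1..m}.
       (\<forall>i j j'. (i, j) \<in> young_diagram l lam \<and> (i, j') \<in> young_diagram l lam \<and> j \<le> j'
          \<longrightarrow> p (i, j') \<le> p (i, j)) \<and>
       (\<forall>i i' j. (i, j) \<in> young_diagram l lam \<and> (i', j) \<in> young_diagram l lam \<and> i \<le> i'
          \<longrightarrow> p (i', j) \<le> p (i, j))}"

definition partial_sum :: "(nat \<Rightarrow> nat) \<Rightarrow> nat \<Rightarrow> nat" where
  "partial_sum x i = (\<Sum>k=1..i. x k)"

definition reversed_partial_sums :: "nat \<Rightarrow> (nat \<Rightarrow> nat) \<Rightarrow> nat \<Rightarrow> nat" where
  "reversed_partial_sums n x i = partial_sum x (n + 1 - i)"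

end

theory Submission
  imports Defs
begin

text \<open>
  A plane partition with entries in \<open>{1, 2}\<close> is determined by the number of 2s in each row, since
  these form an initial segment of the row. Read from the last row to the first, these numbers
  increase weakly and the \<open>i\<close>-th is at most \<open>u\<^sub>i\<close>, so they are exactly the partial sums of the
  integer points \<open>y\<close> of the polytope.
\<close>

lemma partial_sum_0 [simp]: "partial_sum x 0 = 0"
  by (simp add: partial_sum_def)

lemma partial_sum_Suc [simp]: "partial_sum x (Suc i) = partial_sum x i + x (Suc i)"
  by (simp add: partial_sum_def)

lemma partial_sum_mono: "i \<le> j \<Longrightarrow> partial_sum x i \<le> partial_sum x j"
  unfolding partial_sum_def by (rule sum_mono2) auto

lemma is_partition_reversed_partial_sums: "is_partition n (reversed_partial_sums n x)"
  unfolding is_partition_def reversed_partial_sums_def by (auto intro: partial_sum_mono)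

text \<open>The sum telescopes from \<open>c 0 = 0\<close>. Monotonicity of \<open>c\<close> matters
  because subtraction on naturals truncates at 0.\<close>

lemma partial_sum_differences:
  assumes "c 0 = 0" and "\<And>k. k < n \<Longrightarrow> c k \<le> c (Suc k)"
    and "\<And>k. 1 \<le> k \<Longrightarrow> k \<le> n \<Longrightarrow> y k = c k - c (k - 1)" and "k \<le> n"
  shows "partial_sum y k = c k"
  using \<open>k \<le> n\<close>
proof (induction k)
  case 0
  then show ?case using assms(1) by simp
next
  case (Suc k)
  then show ?case using assms(2)[of k] assms(3)[of "Suc k"] by simp
qed

text \<open>Consecutive partial sums differ by one entry, so they recover the vector on
  \<open>{1..n}\<close>; extensionality fixes it elsewhere.\<close>

lemma extensional_eq_if_partial_sums_eq:
  assumes "y \<in> extensional {1..n}" and "z \<in> extensional {1..n}"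
    and eq: "\<And>k. 1 \<le> k \<Longrightarrow> k \<le> n \<Longrightarrow> partial_sum y k = partial_sum z k"
  shows "y = z"
proof (rule extensionalityI[OF assms(1,2)])
  fix k assume "k \<in> {1..n}"
  then obtain m where m: "k = Suc m" "Suc m \<le> n" by (cases k) auto
  have "partial_sum y m = partial_sum z m"
    using eq[of m] m by (cases m) auto
  with eq[of k] m show "y k = z k" by simp
qed

text \<open>A nonempty finite down-closed set of positive integers is filled up to its maximum,
  which is then its cardinality. It will be applied to the columns holding a 2 in a given
  row.\<close>

lemma initial_segment_eq_atLeastAtMost_card:
  assumes "S \<subseteq> {1..N::nat}" and "\<And>i j. j \<in> S \<Longrightarrow> 1 \<le> i \<Longrightarrow> i \<le> j \<Longrightarrow> i \<in> S"
  shows "S = {1..card S}"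
proof (cases "S = {}")
  case False
  have fin: "finite S" using assms(1) finite_subset by blast
  have "S = {1..Max S}"
  proof (intro equalityI subsetI)
    fix i assume "i \<in> S"
    then show "i \<in> {1..Max S}" using assms(1) Max_ge[OF fin] by auto
  next
    fix i assume "i \<in> {1..Max S}"
    then show "i \<in> S" using assms(2)[OF Max_in[OF fin False]] by simp
  qed
  then show ?thesis by (metis card_atLeastAtMost diff_Suc_1)
qed simp

text \<open>The integer points of the polytope, with integrality and nonnegativity absorbed into the
  type \<open>nat\<close>.\<close>

definition dominated_vectors :: "nat \<Rightarrow> (nat \<Rightarrow> nat) \<Rightarrow> (nat \<Rightarrow> nat) set" where
  "dominated_vectors n x =
    {y \<in> {1..n} \<rightarrow>\<^sub>E UNIV. \<forall>i\<in>{1..n}. partial_sum y i \<le> partial_sum x i}"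

lemma pitman_stanley_integer_points_eq:
  "pitman_stanley n (\<lambda>i. real (x i)) \<inter> ({1..n} \<rightarrow>\<^sub>E \<int>) =
    (\<lambda>y. \<lambda>i\<in>{1..n}. real (y i)) ` dominated_vectors n x" (is "?L = ?g ` _")
proof (intro equalityI subsetI)
  fix y assume y: "y \<in> ?L"
  \<comment> \<open>On nonnegative integers \<open>nat\<close> of the floor undoes the embedding
    \<open>real\<close>.\<close>
  define z where "z = (\<lambda>i\<in>{1..n}. nat \<lfloor>y i\<rfloor>)"
  have yz: "real (z i) = y i" if "i \<in> {1..n}" for i
  proof -
    have "y i \<in> \<int>" "0 \<le> y i" using y that by (auto simp: pitman_stanley_def PiE_def)
    then show ?thesis using that by (auto simp: z_def elim: Ints_cases)
  qed
  have "partial_sum z i \<le> partial_sum x i" if i: "i \<in> {1..n}" for i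
  proof -
    have "real (partial_sum z i) = (\<Sum>k=1..i. y k)"
      using i by (auto simp: partial_sum_def yz intro!: sum.cong)
    also have "\<dots> \<le> real (partial_sum x i)"
      using y i by (auto simp: pitman_stanley_def partial_sum_def)
    finally show ?thesis by simp
  qed
  then have "z \<in> dominated_vectors n x" by (auto simp: dominated_vectors_def z_def)
  moreover have "y = ?g z"
    using y by (intro extensionalityI[of y "{1..n}"]) (auto simp: pitman_stanley_def PiE_def yz)
  ultimately show "y \<in> ?g ` dominated_vectors n x" by blast
next
  fix y assume "y \<in> ?g ` dominated_vectors n x"
  then obtain z where z: "z \<in> dominated_vectors n x" and y: "y = ?g z" by blast
  have "(\<Sum>k=1..i. y k) \<le> (\<Sum>k=1..i. real (x k))" if i: "i \<in> {1..n}" for i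
  proof -
    have "(\<Sum>k=1..i. y k) = real (partial_sum z i)"
      using i by (auto simp: partial_sum_def y intro!: sum.cong)
    also have "\<dots> \<le> real (partial_sum x i)"
      using z i by (simp add: dominated_vectors_def)
    finally show ?thesis by (simp add: partial_sum_def)
  qed
  then show "y \<in> ?L" by (auto simp: pitman_stanley_def y)
qed

lemma num_integer_points_pitman_stanley:
  "num_integer_points n (pitman_stanley n (\<lambda>i. real (x i))) = card (dominated_vectors n x)"
proof -
  have "inj_on (\<lambda>y. \<lambda>i\<in>{1..n}. real (y i)) (dominated_vectors n x)"
  proof (rule inj_onI)
    fix y z assume yz: "y \<in> dominated_vectors n x" "z \<in> dominated_vectors n x"
      and eq: "(\<lambda>i\<in>{1..n}. real (y i)) = (\<lambda>i\<in>{1..n}. real (z i))"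
    show "y = z"
    proof (rule extensionalityI[of y "{1..n}"])
      fix i assume "i \<in> {1..n}"
      then show "y i = z i" using fun_cong[OF eq, of i] by simp
    qed (use yz in \<open>auto simp: dominated_vectors_def PiE_def\<close>)
  qed
  then show ?thesis
    unfolding num_integer_points_def pitman_stanley_integer_points_eq by (rule card_image)
qed

text \<open>The index \<open>n + 1 - i\<close> pairs each row with the partial sum of
  \<open>y\<close> whose bound in \<open>dominated_vectors\<close> is the length of that
  row.\<close>

definition array_of_vector :: "nat \<Rightarrow> (nat \<Rightarrow> nat) \<Rightarrow> (nat \<Rightarrow> nat) \<Rightarrow> nat \<times> nat \<Rightarrow> int" where
  "array_of_vector n x y =
    (\<lambda>(i, j)\<in>young_diagram n (reversed_partial_sums n x).
       if j \<le> partial_sum y (n + 1 - i) then 2 else 1)"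

lemma mem_young_diagram_reversed_iff:
  "(i, j) \<in> young_diagram n (reversed_partial_sums n x) \<longleftrightarrow>
    1 \<le> i \<and> i \<le> n \<and> 1 \<le> j \<and> j \<le> partial_sum x (n + 1 - i)"
  by (auto simp: young_diagram_def reversed_partial_sums_def)

text \<open>Along a row the 2s precede the 1s. Down a column the cutoff moves left, since lower rows
  use earlier partial sums.\<close>

lemma array_of_vector_in_plane_partitions:
  "array_of_vector n x y \<in> plane_partitions n (reversed_partial_sums n x) 2"
proof -
  have "j \<le> partial_sum y (n + 1 - i)" if "i \<le> i'" "j \<le> partial_sum y (n + 1 - i')" for i i' j
    using that partial_sum_mono[of "n + 1 - i'" "n + 1 - i" y] by linarith
  then show ?thesis
    by (auto simp: plane_partitions_def array_of_vector_def)
qed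

text \<open>Counting the 2s in row \<open>n + 1 - k\<close> gives back the \<open>k\<close>-th
  partial sum, and the partial sums determine the vector.\<close>

lemma inj_on_array_of_vector: "inj_on (array_of_vector n x) (dominated_vectors n x)"
proof (rule inj_onI)
  fix y z assume yz: "y \<in> dominated_vectors n x" "z \<in> dominated_vectors n x"
    and eq: "array_of_vector n x y = array_of_vector n x z"
  have count: "card {j. (n + 1 - k, j) \<in> young_diagram n (reversed_partial_sums n x) \<and>
      array_of_vector n x w (n + 1 - k, j) = 2} = partial_sum w k"
    if "w \<in> dominated_vectors n x" "1 \<le> k" "k \<le> n" for w k
  proof -
    \<comment> \<open>Domination keeps the cutoff within the row, so no 2s are lost beyond its
      end.\<close>
    have "partial_sum w k \<le> partial_sum x k" using that by (simp add: dominated_vectors_def)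
    then have "{j. (n + 1 - k, j) \<in> young_diagram n (reversed_partial_sums n x) \<and>
      array_of_vector n x w (n + 1 - k, j) = 2} = {1..partial_sum w k}"
      using that by (auto simp: array_of_vector_def mem_young_diagram_reversed_iff)
    then show ?thesis by simp
  qed
  show "y = z"
  proof (rule extensional_eq_if_partial_sums_eq)
    fix k assume "1 \<le> k" "k \<le> n"
    then show "partial_sum y k = partial_sum z k"
      using count[OF yz(1)] count[OF yz(2)] eq by metis
  qed (use yz in \<open>auto simp: dominated_vectors_def PiE_def\<close>)
qed

text \<open>The preimage is the vector of differences of the row counts of 2s, taken from the bottom
  row upwards.\<close>

lemma plane_partition_in_image_array_of_vector:
  assumes p: "p \<in> plane_partitions n (reversed_partial_sums n x) 2"
  shows "p \<in> array_of_vector n x ` dominated_vectors n x"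
proof -
  let ?D = "young_diagram n (reversed_partial_sums n x)"
  have ext: "p \<in> extensional ?D" using p by (auto simp: plane_partitions_def PiE_def)
  have range: "1 \<le> p d \<and> p d \<le> 2" if "d \<in> ?D" for d
    using p that by (force simp: plane_partitions_def dest: PiE_mem)
  have row: "p (i, j') \<le> p (i, j)" if "(i, j) \<in> ?D" "(i, j') \<in> ?D" "j \<le> j'" for i j j'
    using p that unfolding plane_partitions_def by blast
  have col: "p (i', j) \<le> p (i, j)" if "(i, j) \<in> ?D" "(i', j) \<in> ?D" "i \<le> i'" for i i' j
    using p that unfolding plane_partitions_def by blast
  define S where "S k = {j \<in> {1..partial_sum x k}. p (n + 1 - k, j) = 2}" for k
  define c where "c k = card (S k)" for k
  have S_eq: "S k = {1..c k}" if "1 \<le> k" "k \<le> n" for k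
    unfolding c_def
  proof (rule initial_segment_eq_atLeastAtMost_card)
    show "S k \<subseteq> {1..partial_sum x k}" by (auto simp: S_def)
    fix i j assume j: "j \<in> S k" and i: "1 \<le> i" "i \<le> j"
    have D: "(n + 1 - k, i) \<in> ?D" "(n + 1 - k, j) \<in> ?D"
      using that i j by (auto simp: S_def mem_young_diagram_reversed_iff)
    then show "i \<in> S k"
      using row[OF D \<open>i \<le> j\<close>] range[OF D(1)] i j by (auto simp: S_def)
  qed
  \<comment> \<open>No row \<open>n + 1\<close> exists, but \<open>S 0\<close> is empty because
    \<open>partial_sum x 0 = 0\<close>.\<close>
  have c0: "c 0 = 0" by (simp add: c_def S_def)
  have c_le: "c k \<le> partial_sum x k" for k
  proof -
    have "S k \<subseteq> {1..partial_sum x k}" unfolding S_def by (rule Collect_subset)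
    from card_mono[OF _ this] show ?thesis by (simp add: c_def)
  qed
  have c_mono: "c k \<le> c (Suc k)" if k: "k < n" for k
  proof (cases "k = 0")
    case False
    \<comment> \<open>Row \<open>n + 1 - Suc k\<close> lies directly above row
      \<open>n + 1 - k\<close> and is at least as long; a 2 below forces a 2 above, as entries are
      at most 2.\<close>
    have "S k \<subseteq> S (Suc k)"
    proof
      fix j assume j: "j \<in> S k"
      have D: "(n + 1 - Suc k, j) \<in> ?D" "(n + 1 - k, j) \<in> ?D"
        using False k j by (auto simp: S_def mem_young_diagram_reversed_iff Suc_diff_le)
      then show "j \<in> S (Suc k)"
        using col[OF D] range[OF D(1)] j by (auto simp: S_def)
    qed
    then show ?thesis unfolding c_def by (intro card_mono) (auto simp: S_def)
  qed (simp add: c0)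
  \<comment> \<open>By \<open>c_mono\<close> these natural subtractions do not truncate, so
    \<open>c\<close> is recovered as the partial sums of \<open>y\<close>.\<close>
  define y where "y = (\<lambda>k\<in>{1..n}. c k - c (k - 1))"
  have y_sum: "partial_sum y k = c k" if "k \<le> n" for k
    using c0 c_mono _ that by (rule partial_sum_differences) (auto simp: y_def)
  have "y \<in> dominated_vectors n x"
    using y_sum c_le by (auto simp: dominated_vectors_def y_def)
  moreover have "p = array_of_vector n x y"
  proof (rule extensionalityI[OF ext])
    show "array_of_vector n x y \<in> extensional ?D" by (simp add: array_of_vector_def)
    fix d assume d: "d \<in> ?D"
    obtain i j where ij: "d = (i, j)" by (cases d)
    define k where "k = n + 1 - i"
    have k: "1 \<le> k" "k \<le> n" "i = n + 1 - k" "1 \<le> j" "j \<le> partial_sum x k"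
      using d by (auto simp: ij k_def mem_young_diagram_reversed_iff)
    have "p d = 2 \<longleftrightarrow> j \<in> S k" using k by (auto simp: ij S_def)
    also have "\<dots> \<longleftrightarrow> j \<le> partial_sum y k" using k by (simp add: S_eq y_sum)
    \<comment> \<open>By \<open>range\<close>, an entry other than 2 is 1, so agreement on the 2s
      suffices.\<close>
    finally show "p d = array_of_vector n x y d"
      using range[OF d] d by (auto simp: array_of_vector_def ij k_def)
  qed
  ultimately show ?thesis by blast
qed

theorem theorem12:
  fixes n :: nat and x :: "nat \<Rightarrow> nat"
  shows "is_partition n (reversed_partial_sums n x) \<and>
    num_integer_points n (pitman_stanley n (\<lambda>i. real (x i))) =
      card (plane_partitions n (reversed_partial_sums n x) 2)"
proof -
  have "bij_betw (array_of_vector n x) (dominated_vectors n x)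
      (plane_partitions n (reversed_partial_sums n x) 2)"
    unfolding bij_betw_def
    using inj_on_array_of_vector array_of_vector_in_plane_partitions
      plane_partition_in_image_array_of_vector by blast
  then show ?thesis
    using is_partition_reversed_partial_sums num_integer_points_pitman_stanley
    by (simp add: bij_betw_same_card)
qed

end
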